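(* Let $\tau,p_1,\dots,p_\tau\ge1$ be integers, $\eta=p_1+\cdots+p_\tau$, $w^1,w^2\in\mathbb{R}^\eta$ with entries $w^k_{i,j}$ ($1\le i\le\tau$, $1\le j\le p_i$), $b^1,b^2\in\mathbb{R}$, and $\widetilde w_{i,j}=w^1_{i,j}-w^2_{i,j}$, with indices labelled so that $\widetilde w_{i,1}\le\cdots\le\widetilde w_{i,p_i}$ for each $i$. Consider the polyhedron $P$ of points $(x,y,z)$, $x=(x_{i,j})$, defined as the intersection of all halfspaces corresponding to the inequalities $$y\le\sum_{i=1}^\tau\left(\widetilde w_{i,J(i)}z+\sum_{j=J(i)+1}^{p_i}(\widetilde w_{i,j}-\widetilde w_{i,J(i)})x_{i,j}+\sum_{j=1}^{p_i}w^2_{i,j}x_{i,j}\right)+(b^1-b^2)z+b^2,$$ one for each mapping $J:\{1,\dots,\tau\}\to\mathbb{Z}$ with $J(i)\in\{1,\dots,p_i\}$ for all $i$. Consider an arbitrary such mapping $J$. Then the inequality for $J$ is irredundant with respect to $P$. That is, removing the halfspace corresponding to the mapping $J$ from the description of $P$ strictly enlarges the feasible set.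
   Context: Different mappings may define the same halfspace; "removing the halfspace corresponding to $J$" means removing that halfspace from the collection of halfspaces (hence all inequalities of the family that define the same halfspace). *)

theory Defs
  imports Complex_Main "HOL-Library.FuncSet"
begin

definition index_set :: "nat \<Rightarrow> (nat \<Rightarrow> nat) \<Rightarrow> (nat \<times> nat) set" where
  "index_set \<tau> p = (SIGMA i:{1..\<tau>}. {1..p i})"

text \<open>The dimension is \<open>\<eta> = p\<^sub>1 + \<cdots> + p\<^sub>\<tau>\<close>.\<close>

lemma card_index_set: "card (index_set \<tau> p) = (\<Sum>i=1..\<tau>. p i)"
  by (simp add: index_set_def)

text \<open>\<open>\<real>\<^sup>\<eta>\<close> with entries labelled by the pairs \<open>(i, j)\<close>: functions that are
  \<^term>\<open>undefined\<close> outside the index set, so that equality is equality of the \<open>\<eta>\<close> entries.\<close>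

definition coord_space :: "nat \<Rightarrow> (nat \<Rightarrow> nat) \<Rightarrow> (nat \<times> nat \<Rightarrow> real) set" where
  "coord_space \<tau> p = index_set \<tau> p \<rightarrow>\<^sub>E UNIV"

definition xyz_space :: "nat \<Rightarrow> (nat \<Rightarrow> nat) \<Rightarrow> ((nat \<times> nat \<Rightarrow> real) \<times> real \<times> real) set" where
  "xyz_space \<tau> p = coord_space \<tau> p \<times> UNIV \<times> UNIV"

definition mappings :: "nat \<Rightarrow> (nat \<Rightarrow> nat) \<Rightarrow> (nat \<Rightarrow> nat) set" where
  "mappings \<tau> p = (\<Pi>\<^sub>E i\<in>{1..\<tau>}. {1..p i})"

definition wdiff :: "(nat \<times> nat \<Rightarrow> real) \<Rightarrow> (nat \<times> nat \<Rightarrow> real) \<Rightarrow> nat \<Rightarrow> nat \<Rightarrow> real" where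
  "wdiff w1 w2 i j = w1 (i, j) - w2 (i, j)"

definition halfspace ::
  "nat \<Rightarrow> (nat \<Rightarrow> nat) \<Rightarrow> (nat \<times> nat \<Rightarrow> real) \<Rightarrow> (nat \<times> nat \<Rightarrow> real) \<Rightarrow> real \<Rightarrow> real
    \<Rightarrow> (nat \<Rightarrow> nat) \<Rightarrow> ((nat \<times> nat \<Rightarrow> real) \<times> real \<times> real) set" where
  "halfspace \<tau> p w1 w2 b1 b2 J =
    {(x, y, z) \<in> xyz_space \<tau> p.
      y \<le> (\<Sum>i=1..\<tau>. wdiff w1 w2 i (J i) * z
                   + (\<Sum>j=J i + 1..p i. (wdiff w1 w2 i j - wdiff w1 w2 i (J i)) * x (i, j))
                   + (\<Sum>j=1..p i. w2 (i, j) * x (i, j)))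
          + (b1 - b2) * z + b2}"

text \<open>The image is a set of halfspaces: mappings that define the same halfspace contribute one
  element.\<close>

definition halfspaces ::
  "nat \<Rightarrow> (nat \<Rightarrow> nat) \<Rightarrow> (nat \<times> nat \<Rightarrow> real) \<Rightarrow> (nat \<times> nat \<Rightarrow> real) \<Rightarrow> real \<Rightarrow> real
    \<Rightarrow> ((nat \<times> nat \<Rightarrow> real) \<times> real \<times> real) set set" where
  "halfspaces \<tau> p w1 w2 b1 b2 = halfspace \<tau> p w1 w2 b1 b2 ` mappings \<tau> p"

text \<open>The feasible set, within an ambient space \<open>S\<close>, of a collection \<open>H\<close> of subsets of \<open>S\<close>.
  Intersecting with \<open>S\<close> matters only for empty \<open>H\<close>, where nothing is constrained.\<close>

definition feasible_set :: "'a set \<Rightarrow> 'a set set \<Rightarrow> 'a set" where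
  "feasible_set S H = S \<inter> \<Inter>H"

definition irredundant :: "'a set \<Rightarrow> 'a set set \<Rightarrow> 'a set \<Rightarrow> bool" where
  "irredundant S H h \<longleftrightarrow> feasible_set S H \<subset> feasible_set S (H - {h})"

end

theory Submission
  imports Defs
begin

text \<open>Up to terms independent of \<open>J\<close>, the right-hand side of the inequality for \<open>J\<close> is a sum over
  \<open>i\<close> of functions of \<open>J(i)\<close> whose increment from \<open>k\<close> to \<open>k + 1\<close> is
  \<open>(d\<^sub>k\<^sub>+\<^sub>1 - d\<^sub>k) (z - (x\<^sub>k\<^sub>+\<^sub>1 + \<cdots> + x\<^sub>p))\<close>, where \<open>d\<close> denotes the differences of the weights.
  At the point with \<open>z = 1\<close>, \<open>x\<^sub>i\<^sub>,\<^sub>J\<^sub>(\<^sub>i\<^sub>) = 2\<close> and all other \<open>x\<close> zero, the second factor is \<open>-1\<close> for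
  \<open>k < J(i)\<close> and \<open>1\<close> for \<open>k \<ge> J(i)\<close>. So the right-hand side for \<open>K\<close> exceeds that for \<open>J\<close> by
  the sum of the \<open>\<bar>d\<^sub>i\<^sub>,\<^sub>K\<^sub>(\<^sub>i\<^sub>) - d\<^sub>i\<^sub>,\<^sub>J\<^sub>(\<^sub>i\<^sub>)\<bar>\<close>. If this vanishes, the two halfspaces are equal by
  monotonicity of \<open>d\<close>; otherwise it is positive, and there are only finitely many \<open>K\<close>, which leaves
  room for a \<open>y\<close> that violates only the halfspace of \<open>J\<close>.\<close>

definition mapping_term :: "nat \<Rightarrow> (nat \<Rightarrow> real) \<Rightarrow> (nat \<Rightarrow> real) \<Rightarrow> real \<Rightarrow> nat \<Rightarrow> real" where
  "mapping_term n d x z k = d k * z + (\<Sum>j=k+1..n. (d j - d k) * x j)"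

text \<open>Monotonicity squeezes \<open>d\<close> to a constant between \<open>k\<close> and
  \<open>l\<close>, so the summands by which the two sums differ vanish.\<close>

lemma mapping_term_cong:
  assumes "mono_on {1..n} d" "k \<in> {1..n}" "l \<in> {1..n}" "d k = d l"
  shows "mapping_term n d x z k = mapping_term n d x z l"
proof -
  have le_case: "mapping_term n d x z k = mapping_term n d x z l"
    if k: "k \<in> {1..n}" and l: "l \<in> {1..n}" and eq: "d k = d l" and "k \<le> l" for k l
  proof -
    have flat: "d j = d k" if "j \<in> {k+1..n} - {l+1..n}" for j
    proof (rule antisym)
      show "d j \<le> d k"
        unfolding eq using that k l \<open>k \<le> l\<close> by (intro mono_onD[OF assms(1)]) auto
      show "d k \<le> d j"
        using that k l \<open>k \<le> l\<close> by (intro mono_onD[OF assms(1)]) auto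
    qed
    have "(\<Sum>j=k+1..n. (d j - d k) * x j) = (\<Sum>j=l+1..n. (d j - d k) * x j)"
      using \<open>k \<le> l\<close> flat by (intro sum.mono_neutral_right) auto
    then show ?thesis
      by (simp add: mapping_term_def eq)
  qed
  show ?thesis
    using le_case assms(2-4) nat_le_linear[of k l] by metis
qed

text \<open>Only \<open>j = l\<close> contributes to the sum, and only if \<open>k < l\<close>,
  which reflects \<open>d k\<close> to \<open>2 * d l - d k\<close>. Monotonicity fixes the sign in
  the absolute value.\<close>

lemma mapping_term_at_spike:
  assumes "mono_on {1..n} d" "k \<in> {1..n}" "l \<in> {1..n}"
    and x: "\<And>j. j \<in> {1..n} \<Longrightarrow> x j = (if j = l then 2 else 0)"
  shows "mapping_term n d x 1 k = d l + \<bar>d k - d l\<bar>"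
proof -
  have "(\<Sum>j=k+1..n. (d j - d k) * x j) = (\<Sum>j=k+1..n. if j = l then 2 * (d l - d k) else 0)"
    using x by (intro sum.cong) auto
  also have "\<dots> = (if k < l then 2 * (d l - d k) else 0)"
    using assms(3) by auto
  finally have eq: "mapping_term n d x 1 k = d k + (if k < l then 2 * (d l - d k) else 0)"
    by (simp add: mapping_term_def)
  show ?thesis
  proof (cases "k < l")
    case True
    then have "d k \<le> d l"
      using assms by (intro mono_onD[OF assms(1)]) auto
    with True eq show ?thesis by simp
  next
    case False
    then have "d l \<le> d k"
      using assms by (intro mono_onD[OF assms(1)]) auto
    with False eq show ?thesis by simp
  qed
qed

text \<open>Separates what depends on \<open>J\<close> from a remainder common to all
  mappings.\<close>

lemma mem_halfspace_iff:
  "(x, y, z) \<in> halfspace \<tau> p w1 w2 b1 b2 J \<longleftrightarrow>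
    x \<in> coord_space \<tau> p \<and>
    y \<le> (\<Sum>i=1..\<tau>. mapping_term (p i) (wdiff w1 w2 i) (\<lambda>j. x (i, j)) z (J i)) +
      ((\<Sum>i=1..\<tau>. \<Sum>j=1..p i. w2 (i, j) * x (i, j)) + (b1 - b2) * z + b2)"
  by (simp add: halfspace_def xyz_space_def mapping_term_def sum.distrib add.assoc)

lemma halfspace_cong:
  assumes "\<And>i. i \<in> {1..\<tau>} \<Longrightarrow> mono_on {1..p i} (wdiff w1 w2 i)"
    and "J \<in> mappings \<tau> p" "K \<in> mappings \<tau> p"
    and "\<And>i. i \<in> {1..\<tau>} \<Longrightarrow> wdiff w1 w2 i (J i) = wdiff w1 w2 i (K i)"
  shows "halfspace \<tau> p w1 w2 b1 b2 J = halfspace \<tau> p w1 w2 b1 b2 K"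
proof -
  have "(\<Sum>i=1..\<tau>. mapping_term (p i) (wdiff w1 w2 i) (\<lambda>j. x (i, j)) z (J i)) =
      (\<Sum>i=1..\<tau>. mapping_term (p i) (wdiff w1 w2 i) (\<lambda>j. x (i, j)) z (K i))"
    for x :: "nat \<times> nat \<Rightarrow> real" and z
    using assms unfolding mappings_def
    by (intro sum.cong refl mapping_term_cong) (auto dest: PiE_mem)
  then show ?thesis
    by (simp only: set_eq_iff split_paired_All mem_halfspace_iff simp_thms)
qed

theorem proposition9:
  fixes \<tau> :: nat and p :: "nat \<Rightarrow> nat"
    and w1 w2 :: "nat \<times> nat \<Rightarrow> real" and b1 b2 :: real
    and J :: "nat \<Rightarrow> nat"
  assumes "\<tau> \<ge> 1"
    and "\<And>i. i \<in> {1..\<tau>} \<Longrightarrow> p i \<ge> 1"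
    and "w1 \<in> coord_space \<tau> p" and "w2 \<in> coord_space \<tau> p"
    and "\<And>i. i \<in> {1..\<tau>} \<Longrightarrow> mono_on {1..p i} (wdiff w1 w2 i)"
    and "J \<in> mappings \<tau> p"
  shows "irredundant (xyz_space \<tau> p) (halfspaces \<tau> p w1 w2 b1 b2) (halfspace \<tau> p w1 w2 b1 b2 J)"
proof -
  let ?S = "xyz_space \<tau> p" and ?H = "halfspaces \<tau> p w1 w2 b1 b2"
  let ?h = "halfspace \<tau> p w1 w2 b1 b2"
  define x where "x = restrict (\<lambda>(i, j). if j = J i then 2 else 0 :: real) (index_set \<tau> p)"
  \<comment> \<open>The factor \<open>1\<close> is the value of \<open>z\<close>, kept so that
    \<open>c\<close> matches the common remainder in \<open>mem_halfspace_iff\<close>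
    literally.\<close>
  define c where "c = (\<Sum>i=1..\<tau>. \<Sum>j=1..p i. w2 (i, j) * x (i, j)) + (b1 - b2) * 1 + b2"
  define base where "base = (\<Sum>i=1..\<tau>. wdiff w1 w2 i (J i)) + c"
  define gap where "gap K = (\<Sum>i=1..\<tau>. \<bar>wdiff w1 w2 i (K i) - wdiff w1 w2 i (J i)\<bar>)" for K
  have x_space: "x \<in> coord_space \<tau> p"
    by (simp add: x_def coord_space_def)
  have mem_iff: "(x, y, 1) \<in> ?h K \<longleftrightarrow> y \<le> base + gap K" if K: "K \<in> mappings \<tau> p" for K y
  proof -
    have "mapping_term (p i) (wdiff w1 w2 i) (\<lambda>j. x (i, j)) 1 (K i) =
        wdiff w1 w2 i (J i) + \<bar>wdiff w1 w2 i (K i) - wdiff w1 w2 i (J i)\<bar>"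
      if "i \<in> {1..\<tau>}" for i
      using that K \<open>J \<in> mappings \<tau> p\<close> unfolding mappings_def
      by (intro mapping_term_at_spike assms(5)) (auto simp: x_def index_set_def dest: PiE_mem)
    then have "(\<Sum>i=1..\<tau>. mapping_term (p i) (wdiff w1 w2 i) (\<lambda>j. x (i, j)) 1 (K i)) + c =
        base + gap K"
      by (simp add: base_def gap_def sum.distrib)
    then show ?thesis
      by (simp only: mem_halfspace_iff x_space c_def simp_thms)
  qed
  have gap_pos: "gap K > 0" if K: "K \<in> mappings \<tau> p" and neq: "?h K \<noteq> ?h J" for K
  proof (rule ccontr)
    assume "\<not> gap K > 0"
    then have "gap K = 0"
      unfolding gap_def by (meson abs_ge_zero sum_nonneg order_antisym not_le)
    then have "\<And>i. i \<in> {1..\<tau>} \<Longrightarrow> wdiff w1 w2 i (K i) = wdiff w1 w2 i (J i)"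
      unfolding gap_def by (subst (asm) sum_nonneg_eq_0_iff) auto
    with neq show False
      using halfspace_cong[OF assms(5) K \<open>J \<in> mappings \<tau> p\<close>] by blast
  qed
  define G where "G = gap ` {K \<in> mappings \<tau> p. ?h K \<noteq> ?h J}"
  \<comment> \<open>\<open>G\<close> is empty if all mappings define the same halfspace; the extra
    \<open>1\<close> keeps the minimum meaningful and positive.\<close>
  define \<epsilon> where "\<epsilon> = Min (insert 1 G)"
  have "finite (mappings \<tau> p)"
    unfolding mappings_def by (intro finite_PiE) auto
  then have fin: "finite (insert 1 G)"
    by (simp add: G_def)
  have "\<epsilon> > 0"
    unfolding \<epsilon>_def using fin gap_pos by (subst Min_gr_iff) (auto simp: G_def)
  have \<epsilon>_le: "\<epsilon> \<le> gap K" if "K \<in> mappings \<tau> p" "?h K \<noteq> ?h J" for K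
    unfolding \<epsilon>_def using fin that by (intro Min_le) (auto simp: G_def)
  \<comment> \<open>Since \<open>gap J = 0\<close>, the bound on \<open>y\<close> is
    \<open>base\<close> for \<open>J\<close>, and at least \<open>base + \<epsilon>\<close> for
    every other halfspace.\<close>
  let ?q = "(x, base + \<epsilon>, 1 :: real)"
  have "?q \<notin> ?h J"
    using \<open>\<epsilon> > 0\<close> by (simp add: mem_iff[OF \<open>J \<in> mappings \<tau> p\<close>] gap_def)
  then have "?q \<notin> feasible_set ?S ?H"
    using \<open>J \<in> mappings \<tau> p\<close> by (auto simp: feasible_set_def halfspaces_def)
  moreover have "?q \<in> ?h K" if "K \<in> mappings \<tau> p" "?h K \<noteq> ?h J" for K
    using \<epsilon>_le[OF that] by (simp add: mem_iff[OF that(1)])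
  then have "?q \<in> \<Inter>(?H - {?h J})"
    unfolding halfspaces_def by (intro InterI) (elim DiffE imageE, simp)
  then have "?q \<in> feasible_set ?S (?H - {?h J})"
    using x_space by (simp add: feasible_set_def xyz_space_def)
  moreover have "feasible_set ?S ?H \<subseteq> feasible_set ?S (?H - {?h J})"
    unfolding feasible_set_def by (intro Int_mono Inter_anti_mono) simp_all
  ultimately show ?thesis
    unfolding irredundant_def psubset_eq by metis
qed

end
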